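(* Let $A$ be an ordered alphabet and let $F$ be a final segment of $A^{\ast}$. The following conditions are equivalent: (i) the injective envelope $\mathcal{S}_F$ is finite; (ii) $F$ is a finite union $F=F_0\cup\dots\cup F_{k-1}$ of final segments, where each $F_i$ is generated by a set $X_i$ of words of the same length $n_i$, namely $X_i=\{u_0u_1\cdots u_{n_i-1}: u_j\in X_{i,j}\text{ for all }j<n_i\}$ for some subsets $X_{i,0},\dots,X_{i,n_i-1}$ of $A$.
   Context: $A$ is a partially ordered set with an order-preserving involution. $A^{\ast}$ is the free monoid of words over $A$, ordered by the Higman ordering: $a_0\cdots a_{n-1}\le b_0\cdots b_{m-1}$ iff there is a strictly increasing map $h:\{0,\dots,n-1\}\to\{0,\dots,m-1\}$ with $a_i\le b_{h(i)}$ for all $i$. A final segment is an upward closed subset; the final segment generated by $X$ is $\uparrow X=\{v: u\le v\text{ for some }u\in X\}$. For $Y\subseteq A^{\ast}$, $FY^{-1}:=\{u\in A^{\ast}:uy\in F\text{ for all }y\in Y\}$, and $\mathcal{S}_F:=\{FY^{-1}:Y\subseteq A^{\ast}\}$. (With a suitable distance this set represents the injective envelope of a two-element metric space $\{x,y\}$ with $d(x,y)=F$.) *)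

theory Defs
  imports Main "HOL-Library.Sublist"
begin

definition higman_le :: "'a::order list \<Rightarrow> 'a list \<Rightarrow> bool" where
  "higman_le u v \<longleftrightarrow>
     (\<exists>h. strict_mono_on {..<length u} h \<and> h ` {..<length u} \<subseteq> {..<length v} \<and>
          (\<forall>i<length u. u ! i \<le> v ! h i))"

lemma higman_le_iff_list_emb: "higman_le u v \<longleftrightarrow> list_emb (\<le>) u v"
proof
  assume "list_emb (\<le>) u v"
  then show "higman_le u v"
  proof induction
    case (list_emb_Nil ys)
    then show ?case by (simp add: higman_le_def)
  next
    case (list_emb_Cons xs ys y)
    then obtain h where "strict_mono_on {..<length xs} h" "h ` {..<length xs} \<subseteq> {..<length ys}"
      "\<forall>i<length xs. xs ! i \<le> ys ! h i" by (auto simp: higman_le_def)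
    then show ?case unfolding higman_le_def
      by (intro exI[of _ "\<lambda>i. Suc (h i)"]) (auto simp: strict_mono_on_def)
  next
    case (list_emb_Cons2 x y xs ys)
    then obtain h where "strict_mono_on {..<length xs} h" "h ` {..<length xs} \<subseteq> {..<length ys}"
      "\<forall>i<length xs. xs ! i \<le> ys ! h i" by (auto simp: higman_le_def)
    then show ?case unfolding higman_le_def using list_emb_Cons2.hyps(1)
      by (intro exI[of _ "\<lambda>i. case i of 0 \<Rightarrow> 0 | Suc j \<Rightarrow> Suc (h j)"])
         (auto simp: strict_mono_on_def nth_Cons image_subset_iff split: nat.splits)
  qed
next
  assume "higman_le u v"
  then show "list_emb (\<le>) u v"
  proof (induction v arbitrary: u)
    case Nil
    then show ?case by (cases u) (auto simp: higman_le_def)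
  next
    case (Cons y ys)
    from Cons.prems obtain h where h: "strict_mono_on {..<length u} h"
        "h ` {..<length u} \<subseteq> {..<length (y # ys)}" "\<forall>i<length u. u ! i \<le> (y # ys) ! h i"
      unfolding higman_le_def by blast
    have mono: "h i < h j" if "i < j" "j < length u" for i j
      using strict_mono_onD[OF h(1), of i j] that by simp
    have ran: "h i < Suc (length ys)" if "i < length u" for i
      using h(2) that by (simp add: image_subset_iff)
    have le: "u ! i \<le> (y # ys) ! h i" if "i < length u" for i
      using h(3) that by blast
    show ?case
    proof (cases u)
      case Nil
      then show ?thesis by simp
    next
      case u: (Cons x xs)
      have pos: "h (Suc i) > 0" if "i < length xs" for i
        using mono[of 0 "Suc i"] that u by simp
      have tl: "higman_le xs ys" unfolding higman_le_def
      proof (intro exI[of _ "\<lambda>i. h (Suc i) - 1"] conjI allI impI)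
        show "strict_mono_on {..<length xs} (\<lambda>i. h (Suc i) - 1)"
        proof (rule strict_mono_onI)
          fix i j assume "i \<in> {..<length xs}" "j \<in> {..<length xs}" "i < j"
          then show "h (Suc i) - 1 < h (Suc j) - 1"
            using mono[of "Suc i" "Suc j"] pos[of i] u by auto
        qed
        show "(\<lambda>i. h (Suc i) - 1) ` {..<length xs} \<subseteq> {..<length ys}"
        proof clarsimp
          fix i assume "i < length xs"
          then show "h (Suc i) - Suc 0 < length ys"
            using ran[of "Suc i"] pos[of i] u by simp
        qed
        fix i assume "i < length xs"
        then show "xs ! i \<le> ys ! (h (Suc i) - 1)"
          using le[of "Suc i"] pos[of i] u by (simp add: nth_Cons')
      qed
      show ?thesis
      proof (cases "h 0 = 0")
        case True
        then have "x \<le> y" using le[of 0] u by simp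
        then show ?thesis using Cons.IH[OF tl] u by simp
      next
        case False
        have pos': "h i > 0" if "i < length u" for i
          using mono[of 0 i] that False by (cases i) auto
        have "higman_le u ys" unfolding higman_le_def
        proof (intro exI[of _ "\<lambda>i. h i - 1"] conjI allI impI)
          show "strict_mono_on {..<length u} (\<lambda>i. h i - 1)"
          proof (rule strict_mono_onI)
            fix i j assume "i \<in> {..<length u}" "j \<in> {..<length u}" "i < j"
            then show "h i - 1 < h j - 1" using mono[of i j] pos'[of i] by auto
          qed
          show "(\<lambda>i. h i - 1) ` {..<length u} \<subseteq> {..<length ys}"
          proof clarsimp
            fix i assume "i < length u"
            then show "h i - Suc 0 < length ys" using ran[of i] pos'[of i] by simp
          qed
          fix i assume "i < length u"
          then show "u ! i \<le> ys ! (h i - 1)" using le[of i] pos'[of i] by (simp add: nth_Cons')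
        qed
        then show ?thesis by (intro list_emb_Cons Cons.IH)
      qed
    qed
  qed
qed

definition final_segment :: "'a::order list set \<Rightarrow> bool" where
  "final_segment F \<longleftrightarrow> (\<forall>u\<in>F. \<forall>v. higman_le u v \<longrightarrow> v \<in> F)"

definition up_closure :: "'a::order list set \<Rightarrow> 'a list set" where
  "up_closure X = {v. \<exists>u\<in>X. higman_le u v}"

definition right_residual :: "'a list set \<Rightarrow> 'a list set \<Rightarrow> 'a list set" where
  "right_residual F Y = {u. \<forall>y\<in>Y. u @ y \<in> F}"

text \<open>With a suitable distance this set represents the injective envelope of a two-element metric
  space. The distance plays no role in its finiteness, so only the set of points is defined.\<close>

definition residual_sets :: "'a list set \<Rightarrow> 'a list set set" where
  "residual_sets F = {right_residual F Y | Y. True}"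

definition product_words :: "nat \<Rightarrow> (nat \<Rightarrow> 'a set) \<Rightarrow> 'a list set" where
  "product_words n X = {u. length u = n \<and> (\<forall>j<n. u ! j \<in> X j)}"

end

theory Submission
  imports Defs
begin

text \<open>Finiteness of \<open>residual_sets F\<close> amounts to finiteness of the set of quotients \<open>F y\<^sup>-\<^sup>1\<close>, the
  states of an automaton reading words from right to left. As \<open>F\<close> is a final segment, prepending
  a letter can only enlarge the state. Deleting from a word of \<open>F\<close> the letters that do not change
  the state leaves a word of \<open>F\<close> that traverses a strictly increasing chain of states, hence of
  bounded length; replacing each of its letters by the set of all letters inducing the same
  transition yields one of finitely many products \<open>X\<^sub>0 \<dots> X\<^sub>n\<^sub>-\<^sub>1\<close>. Conversely, the quotients of the
  final segment generated by such a product are unions of final segments generated by prefixes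
  of the product.\<close>

text \<open>Recursive form of membership in the final segment generated by the product of the sets
  in \<open>l\<close>. Scanning the word once from the left makes induction on a prefix possible;
  \<open>covers_Nil\<close> leaves the unread rest of the word arbitrary.\<close>

inductive covers :: "'a::order set list \<Rightarrow> 'a list \<Rightarrow> bool" where
  covers_Nil [simp, intro]: "covers [] w"
| covers_skip [intro]: "covers l w \<Longrightarrow> covers l (a # w)"
| covers_letter [intro]: "x \<in> S \<Longrightarrow> x \<le> a \<Longrightarrow> covers l w \<Longrightarrow> covers (S # l) (a # w)"

definition cylinder :: "'a::order set list \<Rightarrow> 'a list set" where
  "cylinder l = {w. covers l w}"

lemma covers_append2: "covers l y \<Longrightarrow> covers l (u @ y)"
  by (induction u) auto

lemma covers_append_mono: "covers l1 u \<Longrightarrow> covers l2 y \<Longrightarrow> covers (l1 @ l2) (u @ y)"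
  by (induction rule: covers.induct) (auto intro: covers_append2)

text \<open>A strictly increasing embedding into \<open>u @ y\<close> sends an initial part of
  \<open>l\<close> into \<open>u\<close> and the remainder into \<open>y\<close>. This is what makes
  quotients of cylinders computable.\<close>

lemma covers_append_iff:
  "covers l (u @ y) \<longleftrightarrow> (\<exists>l1 l2. l = l1 @ l2 \<and> covers l1 u \<and> covers l2 y)"
proof
  show "\<exists>l1 l2. l = l1 @ l2 \<and> covers l1 u \<and> covers l2 y" if "covers l (u @ y)"
    using that
  proof (induction u arbitrary: l)
    case Nil
    then show ?case by (intro exI[of _ "[]"] exI[of _ l]) auto
  next
    case (Cons a u)
    from Cons.prems have "covers l (a # (u @ y))" by simp
    then show ?case
    proof cases
      case covers_Nil
      then show ?thesis by auto
    next
      case covers_skip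
      then show ?thesis using Cons.IH by blast
    next
      case (covers_letter x S l')
      from Cons.IH[OF covers_letter(4)] obtain l1 l2
        where "l' = l1 @ l2" "covers l1 u" "covers l2 y" by blast
      then show ?thesis using covers_letter
        by (intro exI[of _ "S # l1"] exI[of _ l2]) auto
    qed
  qed
qed (auto intro: covers_append_mono)

text \<open>The letters \<open>x\<close> chosen by \<open>covers_letter\<close> along a derivation
  spell the generating word \<open>u\<close>.\<close>

lemma cylinder_iff:
  "w \<in> cylinder l \<longleftrightarrow> (\<exists>u. list_all2 (\<in>) u l \<and> list_emb (\<le>) u w)"
proof
  assume "w \<in> cylinder l"
  then have "covers l w" by (simp add: cylinder_def)
  then show "\<exists>u. list_all2 (\<in>) u l \<and> list_emb (\<le>) u w"
  proof induction
    case (covers_letter x S a l w)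
    then obtain u where "list_all2 (\<in>) u l" "list_emb (\<le>) u w" by blast
    then show ?case using covers_letter.hyps by (intro exI[of _ "x # u"]) auto
  qed auto
next
  assume "\<exists>u. list_all2 (\<in>) u l \<and> list_emb (\<le>) u w"
  then obtain u where "list_emb (\<le>) u w" "list_all2 (\<in>) u l" by blast
  then have "covers l w"
    by (induction arbitrary: l) (auto simp: list_all2_Cons1)
  then show "w \<in> cylinder l" by (simp add: cylinder_def)
qed

lemma up_closure_product_words:
  "up_closure (product_words (length l) ((!) l)) = cylinder l"
proof -
  have "product_words (length l) ((!) l) = {u. list_all2 (\<in>) u l}"
    by (auto simp: product_words_def list_all2_conv_all_nth)
  then show ?thesis
    by (auto simp: up_closure_def cylinder_iff higman_le_iff_list_emb)
qed

lemma product_words_cong: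
  "(\<And>j. j < n \<Longrightarrow> X j = Y j) \<Longrightarrow> product_words n X = product_words n Y"
  by (auto simp: product_words_def)

lemma final_segment_up_closure:
  fixes X :: "'a::order list set"
  shows "final_segment (up_closure X)"
proof -
  have "list_emb (\<le>) u w" if "list_emb (\<le>) u v" "list_emb (\<le>) v w" for u v w :: "'a list"
    by (rule list_emb_trans[OF _ that]) (rule order_trans)
  then show ?thesis
    unfolding final_segment_def up_closure_def higman_le_iff_list_emb by blast
qed

lemma final_segmentD:
  "final_segment F \<Longrightarrow> u \<in> F \<Longrightarrow> list_emb (\<le>) u v \<Longrightarrow> v \<in> F"
  by (auto simp: final_segment_def higman_le_iff_list_emb)

lemma union_of_products_iff_cylinders:
  "(\<exists>(k::nat) G (n :: nat \<Rightarrow> nat) (X :: nat \<Rightarrow> nat \<Rightarrow> 'a::order set). F = (\<Union>i<k. G i) \<and>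
       (\<forall>i<k. final_segment (G i) \<and> G i = up_closure (product_words (n i) (X i))))
   \<longleftrightarrow> (\<exists>L. finite L \<and> F = \<Union> (cylinder ` L))"
  (is "?l \<longleftrightarrow> ?r")
proof
  assume ?l
  then obtain k :: nat and G and n :: "nat \<Rightarrow> nat" and X :: "nat \<Rightarrow> nat \<Rightarrow> 'a set"
    where F: "F = (\<Union>i<k. G i)" and G: "\<And>i. i < k \<Longrightarrow> G i = up_closure (product_words (n i) (X i))"
    by blast
  \<comment> \<open>\<open>product_words\<close> reads \<open>X i\<close> only below
    \<open>n i\<close>, so a list of length \<open>n i\<close> carries the same data.\<close>
  define l where "l i = map (X i) [0..<n i]" for i
  have "G i = cylinder (l i)" if "i < k" for i
  proof -
    have "product_words (n i) (X i) = product_words (length (l i)) ((!) (l i))"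
      unfolding l_def length_map length_upt minus_nat.diff_0 by (rule product_words_cong) simp
    then show ?thesis using G[OF that] up_closure_product_words by metis
  qed
  then have "F = \<Union> (cylinder ` l ` {..<k})" using F by auto
  then show ?r by (intro exI[of _ "l ` {..<k}"]) auto
next
  assume ?r
  then obtain L where "finite L" and F: "F = \<Union> (cylinder ` L)" by blast
  then obtain ls where L: "L = set ls" by (metis finite_list)
  have "F = (\<Union>i<length ls. cylinder (ls ! i))"
    unfolding F L set_conv_nth by blast
  moreover have "final_segment (cylinder (ls ! i))" for i
    using final_segment_up_closure up_closure_product_words by metis
  ultimately show ?l
    by (intro exI[of _ "length ls"] exI[of _ "\<lambda>i. cylinder (ls ! i)"]
        exI[of _ "\<lambda>i. length (ls ! i)"] exI[of _ "\<lambda>i. (!) (ls ! i)"])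
      (simp add: up_closure_product_words)
qed

definition quotient :: "'a list set \<Rightarrow> 'a list \<Rightarrow> 'a list set" where
  "quotient F y = {u. u @ y \<in> F}"

text \<open>Quotients are the residuals of singletons, and every residual is an intersection of
  quotients, so finitely many quotients yield finitely many residuals.\<close>

lemma finite_residual_sets_iff:
  "finite (residual_sets F) \<longleftrightarrow> finite (range (quotient F))"
proof
  have "quotient F y = right_residual F {y}" for y
    by (simp add: quotient_def right_residual_def)
  then have "range (quotient F) \<subseteq> residual_sets F" by (auto simp: residual_sets_def)
  then show "finite (residual_sets F) \<Longrightarrow> finite (range (quotient F))"
    by (rule finite_subset)
next
  have "right_residual F Y = \<Inter> (quotient F ` Y)" for Y
    by (auto simp: quotient_def right_residual_def)
  then have "residual_sets F \<subseteq> Inter ` Pow (range (quotient F))"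
    by (auto simp: residual_sets_def)
  then show "finite (range (quotient F)) \<Longrightarrow> finite (residual_sets F)"
    by (rule finite_subset) simp
qed

lemma finite_quotients_cylinders:
  assumes "finite L"
  shows "finite (range (quotient (\<Union> (cylinder ` L))))"
proof -
  \<comment> \<open>All splittings of the lists in \<open>L\<close> into a prefix and a
    suffix.\<close>
  define P where "P = (\<Union>l\<in>L. (\<lambda>m. (take m l, drop m l)) ` {..length l})"
  have P: "(l1, l2) \<in> P \<longleftrightarrow> l1 @ l2 \<in> L" for l1 l2
  proof
    assume "l1 @ l2 \<in> L"
    then show "(l1, l2) \<in> P" unfolding P_def
      by (intro UN_I[of "l1 @ l2"] image_eqI[of _ _ "length l1"]) auto
  qed (auto simp: P_def)
  \<comment> \<open>The word \<open>y\<close> enters only through the set of splittings whose suffix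
    it covers, a subset of the finite set \<open>P\<close>.\<close>
  have "quotient (\<Union> (cylinder ` L)) y = (\<Union>p \<in> {p \<in> P. y \<in> cylinder (snd p)}. cylinder (fst p))" for y
    by (force simp: quotient_def cylinder_def covers_append_iff P)
  then have "range (quotient (\<Union> (cylinder ` L))) \<subseteq> (\<lambda>T. \<Union>p\<in>T. cylinder (fst p)) ` Pow P"
    by blast
  moreover have "finite P" using assms by (simp add: P_def)
  ultimately show ?thesis by (meson finite_Pow_iff finite_imageI finite_subset)
qed

text \<open>The next state depends only on the current state and the letter \<open>a\<close>, so
  transitions between states are well defined.\<close>

lemma quotient_Cons: "quotient F (a # y) = {u. u @ [a] \<in> quotient F y}"
  by (simp add: quotient_def)

lemma quotient_Cons_mono:
  assumes "final_segment F"
  shows "quotient F y \<subseteq> quotient F (a # y)"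
proof
  fix u assume "u \<in> quotient F y"
  moreover have "list_emb (\<le>) (u @ y) (u @ a # y)"
    by (intro list_emb_append_mono list_emb_Cons list_emb_refl order_refl)
  ultimately show "u \<in> quotient F (a # y)"
    unfolding quotient_def by (auto intro: final_segmentD[OF assms])
qed

text \<open>With finitely many states, these sets form a finite alphabet of letter sets, even when
  the type of letters is infinite.\<close>

definition transition_letters :: "'a list set \<Rightarrow> 'a list set \<Rightarrow> 'a set" where
  "transition_letters q q' = {a. {u. u @ [a] \<in> q} = q'}"

text \<open>Each entry of \<open>l\<close> accounts for one strict increase of the state, so
  counting the states below the current one bounds the length. The last conjunct makes every word of
  the product end in the state of \<open>w\<close>.\<close>

lemma short_transition_word:
  assumes "final_segment F" and fin: "finite (range (quotient F))"
  shows "\<exists>l. set l \<subseteq> case_prod transition_letters ` (range (quotient F) \<times> range (quotient F)) \<and>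
    length l < card {q \<in> range (quotient F). q \<subseteq> quotient F w} \<and> w \<in> cylinder l \<and>
    (\<forall>v. list_all2 (\<in>) v l \<longrightarrow> quotient F v = quotient F w)"
proof (induction w)
  case Nil
  \<comment> \<open>The initial state lies below itself; this is why the length bound can be
    strict.\<close>
  have "card {q \<in> range (quotient F). q \<subseteq> quotient F []} > 0"
    using fin by (auto simp: card_gt_0_iff)
  then show ?case by (intro exI[of _ "[]"]) (auto simp: cylinder_def)
next
  case (Cons a w)
  then obtain l where l: "set l \<subseteq> case_prod transition_letters ` (range (quotient F) \<times> range (quotient F))"
    "length l < card {q \<in> range (quotient F). q \<subseteq> quotient F w}" "w \<in> cylinder l"
    "\<And>v. list_all2 (\<in>) v l \<Longrightarrow> quotient F v = quotient F w" by blast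
  show ?case
  proof (cases "quotient F (a # w) = quotient F w")
    case True
    then show ?thesis using l by (intro exI[of _ l]) (auto simp: cylinder_def)
  next
    case False
    define S where "S = transition_letters (quotient F w) (quotient F (a # w))"
    have "a \<in> S" by (simp add: S_def transition_letters_def quotient_Cons)
    then have "a # w \<in> cylinder (S # l)"
      using l(3) by (auto simp: cylinder_def)
    moreover have "set (S # l) \<subseteq> case_prod transition_letters ` (range (quotient F) \<times> range (quotient F))"
      using l(1) by (auto simp: S_def)
    moreover
    have less: "quotient F w \<subset> quotient F (a # w)"
      using quotient_Cons_mono[OF assms(1), of w a] False by simp
    then have "quotient F (a # w) \<notin> {q \<in> range (quotient F). q \<subseteq> quotient F w}"
      by (simp add: less_le_not_le)
    \<comment> \<open>The new state itself witnesses strictness, which pays for the additional entry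
      \<open>S\<close>.\<close>
    then have "{q \<in> range (quotient F). q \<subseteq> quotient F w}
        \<subset> {q \<in> range (quotient F). q \<subseteq> quotient F (a # w)}"
      using less by (intro psubsetI) (force, metis (lifting) mem_Collect_eq order_refl rangeI)
    then have "card {q \<in> range (quotient F). q \<subseteq> quotient F w}
        < card {q \<in> range (quotient F). q \<subseteq> quotient F (a # w)}"
      using fin by (intro psubset_card_mono) simp_all
    then have "length (S # l) < card {q \<in> range (quotient F). q \<subseteq> quotient F (a # w)}"
      using l(2) by simp
    moreover have "quotient F v = quotient F (a # w)" if "list_all2 (\<in>) v (S # l)" for v
      using that l(4) by (auto simp: list_all2_Cons2 S_def transition_letters_def quotient_Cons)
    ultimately show ?thesis by blast
  qed
qed

lemma final_segment_union_of_cylinders: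
  assumes "final_segment F" and fin: "finite (range (quotient F))"
  shows "\<exists>L. finite L \<and> F = \<Union> (cylinder ` L)"
proof -
  define \<X> where "\<X> = case_prod transition_letters ` (range (quotient F) \<times> range (quotient F))"
  \<comment> \<open>Requiring \<open>cylinder l \<subseteq> F\<close> settles one inclusion at once;
    bounded length over the finite alphabet \<open>\<X>\<close> gives finiteness.\<close>
  define L where "L = {l. set l \<subseteq> \<X> \<and> length l \<le> card (range (quotient F)) \<and> cylinder l \<subseteq> F}"
  have "finite \<X>" using fin by (simp add: \<X>_def)
  then have "finite {l. set l \<subseteq> \<X> \<and> length l \<le> card (range (quotient F))}"
    by (rule finite_lists_length_le)
  then have "finite L" by (rule rev_finite_subset) (auto simp: L_def)
  moreover have "\<exists>l\<in>L. w \<in> cylinder l" if "w \<in> F" for w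
  proof -
    obtain l where l: "set l \<subseteq> \<X>"
      "length l < card {q \<in> range (quotient F). q \<subseteq> quotient F w}" "w \<in> cylinder l"
      "\<And>v. list_all2 (\<in>) v l \<Longrightarrow> quotient F v = quotient F w"
      using short_transition_word[OF assms, of w] unfolding \<X>_def by blast
    have "v \<in> F" if "list_all2 (\<in>) v l" for v
    proof -
      \<comment> \<open>The accepting states are those containing the empty word, so words with
        equal quotients are both in \<open>F\<close> or both outside it.\<close>
      have "[] \<in> quotient F v" using l(4)[OF that] \<open>w \<in> F\<close> by (simp add: quotient_def)
      then show ?thesis by (simp add: quotient_def)
    qed
    then have "cylinder l \<subseteq> F" using final_segmentD[OF assms(1)] by (blast dest: cylinder_iff[THEN iffD1])
    moreover have "card {q \<in> range (quotient F). q \<subseteq> quotient F w} \<le> card (range (quotient F))"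
      using fin by (intro card_mono) auto
    ultimately show ?thesis using l by (auto simp: L_def)
  qed
  then have "F = \<Union> (cylinder ` L)" by (auto simp: L_def)
  ultimately show ?thesis by blast
qed

theorem proposition4:
  fixes bar :: "'a::order \<Rightarrow> 'a" and F :: "'a list set"
  assumes "mono bar" and "\<And>a. bar (bar a) = a"
    and "final_segment F"
  shows "finite (residual_sets F) \<longleftrightarrow>
    (\<exists>(k::nat) (G :: nat \<Rightarrow> 'a list set) (n :: nat \<Rightarrow> nat) (X :: nat \<Rightarrow> nat \<Rightarrow> 'a set).
       F = (\<Union>i<k. G i) \<and>
       (\<forall>i<k. final_segment (G i) \<and> G i = up_closure (product_words (n i) (X i))))"
  unfolding union_of_products_iff_cylinders finite_residual_sets_iff
  using final_segment_union_of_cylinders[OF assms(3)] finite_quotients_cylinders by blast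

end
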